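(* Let $w = \psi(\mathbf{tm})$, where $\mathbf{tm}$ is the Thue--Morse word and $\psi$ is the morphism defined by $0 \mapsto 0011$ and $1 \mapsto 0110$. Then for all $\ell>0$ $$\rho_{w, \ell}^{(S_2, S_{\ell})} = \begin{cases} 1 & \text{if } \ell=1\\ 2 & \text{if } \ell>1,\end{cases}$$ where $S_2$ acts by permuting (exchanging) the letters of the alphabet $\{0,1\}$ and $S_\ell$ acts by permuting the $\ell$ positions. Furthermore, $w$ is not a Sturmian word.
   Context: The Thue--Morse word $\mathbf{tm}\in\{0,1\}^\omega$ is the infinite fixed point, beginning with $0$, of the morphism $0 \mapsto 01$, $1 \mapsto 10$. A factor of an infinite word is a finite contiguous subsequence. Let $G$ be a group acting on an alphabet $\Sigma$, hence letterwise on words, and let $H_\ell$ be a group acting on $\Sigma^\ell$ by permuting positions; then $G \times H_\ell$ acts on $\Sigma^\ell$ by $(g,h)\cdot w = g\cdot(h\cdot w) = h\cdot(g\cdot w)$. For an infinite word $w$ over $\Sigma$, $\rho_{w,\ell}^{(G,H_\ell)}$ denotes the number of equivalence classes in the set of length-$\ell$ factors of $w$, where two factors are equivalent if they lie in the same $G\times H_\ell$-orbit in $\Sigma^\ell$. A Sturmian word is an infinite binary word having exactly $\ell+1$ distinct factors of length $\ell$ for every $\ell>0$. *)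

theory Defs
  imports "HOL-Algebra.Group_Action" "HOL-Combinatorics.Permutations" "HOL-Library.Stream"
begin

section \<open>Infinite words, morphisms and factors\<close>

text \<open>
  A morphism is given by its letter images. It extends to infinite words by concatenating these
  images; all morphisms below are non-erasing, as \<^const>\<open>flat\<close> requires.
\<close>

definition morphic_image :: "('a \<Rightarrow> 'b list) \<Rightarrow> 'a stream \<Rightarrow> 'b stream" where
  "morphic_image f w = flat (smap f w)"

definition factors :: "nat \<Rightarrow> 'a stream \<Rightarrow> 'a list set" where
  "factors l w = {stake l (sdrop i w) | i. True}"

abbreviation binary :: "nat set" where
  "binary \<equiv> {0, 1}"

text \<open>
  Letters are natural numbers and only \<open>0\<close> and \<open>1\<close> occur; the values of the following two
  morphisms at other letters are irrelevant.
\<close>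

definition tm_morphism :: "nat \<Rightarrow> nat list" where
  "tm_morphism a = (if a = 0 then [0, 1] else [1, 0])"

definition psi :: "nat \<Rightarrow> nat list" where
  "psi a = (if a = 0 then [0, 0, 1, 1] else [0, 1, 1, 0])"

text \<open>The description is proper: see \<open>ex1_thue_morse\<close> below.\<close>

definition thue_morse :: "nat stream" where
  "thue_morse = (THE w. w \<in> streams binary \<and> shd w = 0 \<and> morphic_image tm_morphism w = w)"

definition sturmian :: "nat stream \<Rightarrow> bool" where
  "sturmian w \<longleftrightarrow> w \<in> streams binary \<and> (\<forall>l>0. card (factors l w) = l + 1)"


section \<open>Group actions on words of fixed length\<close>

definition words :: "'a set \<Rightarrow> nat \<Rightarrow> 'a list set" where
  "words \<Sigma> l = {u. set u \<subseteq> \<Sigma> \<and> length u = l}"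

text \<open>
  The action \<open>\<phi>\<close> of \<open>G\<close> on the alphabet extends letterwise. The action \<open>\<theta>\<close> of \<open>H\<close> on the positions
  \<open>{..<l}\<close> moves the letter at position \<open>i\<close> to position \<open>\<theta> h i\<close>; hence the inverse in the
  formula, which makes this a left action. As \<^locale>\<open>group_action\<close> requires, the functions are
  extensional, i.e. restricted to the words of length \<open>l\<close>.
\<close>

definition letter_action :: "('g \<Rightarrow> 'a \<Rightarrow> 'a) \<Rightarrow> 'a set \<Rightarrow> nat \<Rightarrow> 'g \<Rightarrow> 'a list \<Rightarrow> 'a list" where
  "letter_action \<phi> \<Sigma> l g = (\<lambda>u\<in>words \<Sigma> l. map (\<phi> g) u)"

definition position_action ::
  "('h, 'c) monoid_scheme \<Rightarrow> ('h \<Rightarrow> nat \<Rightarrow> nat) \<Rightarrow> 'a set \<Rightarrow> nat \<Rightarrow> 'h \<Rightarrow> 'a list \<Rightarrow> 'a list" where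
  "position_action H \<theta> \<Sigma> l h = (\<lambda>u\<in>words \<Sigma> l. permute_list (\<theta> (inv\<^bsub>H\<^esub> h)) u)"

definition word_action ::
  "('g \<Rightarrow> 'a \<Rightarrow> 'a) \<Rightarrow> ('h, 'c) monoid_scheme \<Rightarrow> ('h \<Rightarrow> nat \<Rightarrow> nat) \<Rightarrow> 'a set \<Rightarrow> nat
    \<Rightarrow> 'g \<times> 'h \<Rightarrow> 'a list \<Rightarrow> 'a list" where
  "word_action \<phi> H \<theta> \<Sigma> l =
     (\<lambda>(g, h). \<lambda>u\<in>words \<Sigma> l. letter_action \<phi> \<Sigma> l g (position_action H \<theta> \<Sigma> l h u))"

definition factor_equiv ::
  "('g, 'b) monoid_scheme \<Rightarrow> ('g \<Rightarrow> 'a \<Rightarrow> 'a) \<Rightarrow> ('h, 'c) monoid_scheme \<Rightarrow> ('h \<Rightarrow> nat \<Rightarrow> nat)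
    \<Rightarrow> 'a set \<Rightarrow> 'a stream \<Rightarrow> nat \<Rightarrow> ('a list \<times> 'a list) set" where
  "factor_equiv G \<phi> H \<theta> \<Sigma> w l =
     {(u, v). u \<in> factors l w \<and> v \<in> factors l w \<and>
        (\<exists>Orb \<in> orbits (G \<times>\<times> H) (words \<Sigma> l) (word_action \<phi> H \<theta> \<Sigma> l). u \<in> Orb \<and> v \<in> Orb)}"

definition group_complexity ::
  "('g, 'b) monoid_scheme \<Rightarrow> ('g \<Rightarrow> 'a \<Rightarrow> 'a) \<Rightarrow> ('h, 'c) monoid_scheme \<Rightarrow> ('h \<Rightarrow> nat \<Rightarrow> nat)
    \<Rightarrow> 'a set \<Rightarrow> 'a stream \<Rightarrow> nat \<Rightarrow> nat" where
  "group_complexity G \<phi> H \<theta> \<Sigma> w l = card (factors l w // factor_equiv G \<phi> H \<theta> \<Sigma> w l)"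

text \<open>
  \<open>\<rho>\<close> for the natural actions of the full symmetric groups of the alphabet and of the positions.
\<close>

definition symmetric_complexity :: "'a set \<Rightarrow> 'a stream \<Rightarrow> nat \<Rightarrow> nat" where
  "symmetric_complexity \<Sigma> w l =
     group_complexity (BijGroup \<Sigma>) (\<lambda>g. g) (BijGroup {..<l}) (\<lambda>h. h) \<Sigma> w l"


section \<open>The definitions are meaningful\<close>

lemma snth_ext: "(\<And>n. u !! n = v !! n) \<Longrightarrow> u = v"
  by (metis ext stream_smap_nats)

lemma snth_morphic_image:
  assumes k: "k > 0" and len: "\<And>a. length (f a) = k"
  shows "morphic_image f w !! n = f (w !! (n div k)) ! (n mod k)"
proof (induction n arbitrary: w rule: less_induct)
  case (less n)
  have ne: "f (shd w) \<noteq> []" using k len by (metis length_0_conv less_numeral_extra(3))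
  then have unf: "morphic_image f w = f (shd w) @- morphic_image f (stl w)"
    using flat_unfold[of "smap f w"] by (simp add: morphic_image_def)
  show ?case
  proof (cases "n < k")
    case True
    then show ?thesis by (simp add: unf shift_snth len)
  next
    case False
    then have "n div k = Suc ((n - k) div k)" "n mod k = (n - k) mod k"
      using k by (simp_all add: le_div_geq le_mod_geq)
    then show ?thesis
      using less.IH[of "n - k" "stl w"] False k by (simp add: unf shift_snth len)
  qed
qed

fun thue_morse_letter :: "nat \<Rightarrow> nat" where
  "thue_morse_letter n =
     (if n = 0 then 0 else tm_morphism (thue_morse_letter (n div 2)) ! (n mod 2))"

declare thue_morse_letter.simps [simp del]

lemma ex1_thue_morse:
  "\<exists>!w. w \<in> streams binary \<and> shd w = 0 \<and> morphic_image tm_morphism w = w"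
proof (rule ex1I)
  have image: "morphic_image tm_morphism v !! n = tm_morphism (v !! (n div 2)) ! (n mod 2)" for v n
    by (rule snth_morphic_image) (simp_all add: tm_morphism_def)
  let ?u = "smap thue_morse_letter nats"
  have zero: "thue_morse_letter 0 = 0" by (simp add: thue_morse_letter.simps)
  have letter: "thue_morse_letter n = tm_morphism (thue_morse_letter (n div 2)) ! (n mod 2)" for n
    by (cases "n = 0") (simp add: zero tm_morphism_def, subst thue_morse_letter.simps, simp)
  have bin: "tm_morphism a ! (n mod 2) \<in> binary" for a n
    by (cases "even n") (auto simp: tm_morphism_def even_iff_mod_2_eq_zero odd_iff_mod_2_eq_one)
  have "thue_morse_letter n \<in> binary" for n
    using letter[of n] bin[of "thue_morse_letter (n div 2)" n] by simp
  then have "?u \<in> streams binary"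
    by (simp only: streams_iff_snth snth_smap) blast
  moreover have "morphic_image tm_morphism ?u = ?u"
    by (rule snth_ext) (simp add: image letter[symmetric])
  ultimately show "?u \<in> streams binary \<and> shd ?u = 0 \<and> morphic_image tm_morphism ?u = ?u"
    by (simp add: zero)
  fix w :: "nat stream"
  assume w: "w \<in> streams binary \<and> shd w = 0 \<and> morphic_image tm_morphism w = w"
  have "w !! n = thue_morse_letter n" for n
  proof (induction n rule: less_induct)
    case (less n)
    show ?case
    proof (cases "n = 0")
      case True
      then show ?thesis using w zero by simp
    next
      case False
      then show ?thesis using less.IH[of "n div 2"] image[of w n] letter[of n] w by simp
    qed
  qed
  then show "w = ?u" by (intro snth_ext) simp
qed

lemma thue_morse_fixed_point:
  "thue_morse \<in> streams binary" "shd thue_morse = 0"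
  "morphic_image tm_morphism thue_morse = thue_morse"
  using theI'[OF ex1_thue_morse] unfolding thue_morse_def by blast+

lemma group_action_BijGroup: "group_action (BijGroup S) S (\<lambda>g. g)"
  by (simp add: group_action_def group_hom_def group_hom_axioms_def group_BijGroup hom_def)

lemma group_actionI:
  assumes G: "group G"
    and ext: "\<And>g. g \<in> carrier G \<Longrightarrow> \<phi> g \<in> extensional E"
    and closed: "\<And>g x. g \<in> carrier G \<Longrightarrow> x \<in> E \<Longrightarrow> \<phi> g x \<in> E"
    and one: "\<And>x. x \<in> E \<Longrightarrow> \<phi> \<one>\<^bsub>G\<^esub> x = x"
    and mult: "\<And>g h x. g \<in> carrier G \<Longrightarrow> h \<in> carrier G \<Longrightarrow> x \<in> E \<Longrightarrow> \<phi> (g \<otimes>\<^bsub>G\<^esub> h) x = \<phi> g (\<phi> h x)"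
  shows "group_action G E \<phi>"
proof -
  interpret G: group G by (rule G)
  have bij: "\<phi> g \<in> Bij E" if g: "g \<in> carrier G" for g
  proof -
    have "\<phi> (inv\<^bsub>G\<^esub> g) (\<phi> g x) = x" "\<phi> g (\<phi> (inv\<^bsub>G\<^esub> g) x) = x" if "x \<in> E" for x
      using mult[OF _ g that, of "inv\<^bsub>G\<^esub> g"] mult[OF g _ that, of "inv\<^bsub>G\<^esub> g"] g one[OF that] by simp_all
    then have "bij_betw (\<phi> g) E E"
      using closed g by (intro bij_betw_byWitness[where f' = "\<phi> (inv\<^bsub>G\<^esub> g)"]) auto
    then show ?thesis
      using ext[OF g] by (simp add: Bij_def)
  qed
  have "\<phi> \<in> hom G (BijGroup E)"
  proof (rule homI)
    show "\<phi> (x \<otimes>\<^bsub>G\<^esub> y) = \<phi> x \<otimes>\<^bsub>BijGroup E\<^esub> \<phi> y" if "x \<in> carrier G" "y \<in> carrier G" for x y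
    proof (rule extensionalityI[where A = E])
      show "\<phi> (x \<otimes>\<^bsub>G\<^esub> y) \<in> extensional E" using that by (intro ext) simp
    qed (use that bij mult in \<open>simp_all add: BijGroup_def compose_def\<close>)
  qed (use bij in \<open>simp add: BijGroup_def\<close>)
  then show ?thesis
    by (simp add: group_action_def group_hom_def group_hom_axioms_def group_BijGroup G)
qed

lemma letter_action:
  assumes "group_action G \<Sigma> \<phi>"
  shows "group_action G (words \<Sigma> l) (letter_action \<phi> \<Sigma> l)"
proof -
  interpret A: group_action G \<Sigma> \<phi> by (rule assms)
  interpret G: group G using A.group_hom by (simp add: group_hom_def)
  have closed: "map (\<phi> g) u \<in> words \<Sigma> l" if "g \<in> carrier G" "u \<in> words \<Sigma> l" for g u
    using that A.element_image by (fastforce simp: words_def)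
  show ?thesis
  proof (rule group_actionI[OF G.group_axioms])
    show "letter_action \<phi> \<Sigma> l \<one>\<^bsub>G\<^esub> u = u" if "u \<in> words \<Sigma> l" for u
      using that by (auto simp: letter_action_def words_def A.id_eq_one[symmetric] intro!: map_idI)
    show "letter_action \<phi> \<Sigma> l (g \<otimes>\<^bsub>G\<^esub> h) u = letter_action \<phi> \<Sigma> l g (letter_action \<phi> \<Sigma> l h u)"
      if "g \<in> carrier G" "h \<in> carrier G" "u \<in> words \<Sigma> l" for g h u
      using that closed[OF that(2,3)]
      by (auto simp: letter_action_def words_def A.composition_rule)
  qed (simp_all add: letter_action_def closed)
qed

lemma position_action:
  assumes "group_action H {..<l} \<theta>"
  shows "group_action H (words \<Sigma> l) (position_action H \<theta> \<Sigma> l)"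
proof -
  interpret A: group_action H "{..<l}" \<theta> by (rule assms)
  interpret H: group H using A.group_hom by (simp add: group_hom_def)
  have in_range: "\<theta> h i < l" if "h \<in> carrier H" "i < l" for h i
    using A.element_image[OF that(1), of i] that(2) by simp
  have closed: "permute_list (\<theta> h) u \<in> words \<Sigma> l" if "h \<in> carrier H" "u \<in> words \<Sigma> l" for h u
    using that in_range by (auto simp: words_def permute_list_def)
  show ?thesis
  proof (rule group_actionI[OF H.group_axioms])
    show "position_action H \<theta> \<Sigma> l \<one>\<^bsub>H\<^esub> u = u" if "u \<in> words \<Sigma> l" for u
      using that
      by (auto simp: position_action_def words_def A.id_eq_one[symmetric] permute_list_def
          intro!: nth_equalityI)
    show "position_action H \<theta> \<Sigma> l (g \<otimes>\<^bsub>H\<^esub> h) u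
        = position_action H \<theta> \<Sigma> l g (position_action H \<theta> \<Sigma> l h u)"
      if "g \<in> carrier H" "h \<in> carrier H" "u \<in> words \<Sigma> l" for g h u
      using that closed[OF H.inv_closed[OF that(2)] that(3)] in_range[OF H.inv_closed[OF that(1)]]
      by (auto simp: position_action_def words_def permute_list_def H.inv_mult_group
          A.composition_rule intro!: nth_equalityI)
  qed (simp_all add: position_action_def closed)
qed

lemma letter_position_commute:
  assumes "group_action G \<Sigma> \<phi>" and "group_action H {..<l} \<theta>"
    and "g \<in> carrier G" and "h \<in> carrier H" and u: "u \<in> words \<Sigma> l"
  shows "letter_action \<phi> \<Sigma> l g (position_action H \<theta> \<Sigma> l h u)
       = position_action H \<theta> \<Sigma> l h (letter_action \<phi> \<Sigma> l g u)"
proof -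
  interpret A: group_action H "{..<l}" \<theta> by (rule assms)
  interpret H: group H using A.group_hom by (simp add: group_hom_def)
  have *: "\<theta> (inv\<^bsub>H\<^esub> h) i < l" if "i < l" for i
    using A.element_image[of "inv\<^bsub>H\<^esub> h" i] that assms(4) by simp
  have "letter_action \<phi> \<Sigma> l g u \<in> words \<Sigma> l" "position_action H \<theta> \<Sigma> l h u \<in> words \<Sigma> l"
    using group_action.element_image[OF letter_action[OF assms(1)] assms(3) u]
      group_action.element_image[OF position_action[OF assms(2)] assms(4) u] by simp_all
  then show ?thesis
    using u * by (auto simp: letter_action_def position_action_def words_def permute_list_def)
qed

lemma word_action:
  assumes G: "group_action G \<Sigma> \<phi>" and H: "group_action H {..<l} \<theta>"
  shows "group_action (G \<times>\<times> H) (words \<Sigma> l) (word_action \<phi> H \<theta> \<Sigma> l)"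
proof -
  interpret L: group_action G "words \<Sigma> l" "letter_action \<phi> \<Sigma> l" by (rule letter_action[OF G])
  interpret P: group_action H "words \<Sigma> l" "position_action H \<theta> \<Sigma> l" by (rule position_action[OF H])
  have "group G" "group H" using L.group_hom P.group_hom by (simp_all add: group_hom_def)
  then interpret GH: group "G \<times>\<times> H" by (rule DirProd_group)
  have Lc: "letter_action \<phi> \<Sigma> l g u \<in> words \<Sigma> l" if "g \<in> carrier G" "u \<in> words \<Sigma> l" for g u
    using L.element_image that by blast
  have Pc: "position_action H \<theta> \<Sigma> l h u \<in> words \<Sigma> l" if "h \<in> carrier H" "u \<in> words \<Sigma> l" for h u
    using P.element_image that by blast
  show ?thesis
  proof (rule group_actionI[OF GH.group_axioms])
    show "word_action \<phi> H \<theta> \<Sigma> l \<one>\<^bsub>G \<times>\<times> H\<^esub> u = u" if "u \<in> words \<Sigma> l" for u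
      using that by (simp add: word_action_def L.id_eq_one[symmetric] P.id_eq_one[symmetric])
    show "word_action \<phi> H \<theta> \<Sigma> l (x \<otimes>\<^bsub>G \<times>\<times> H\<^esub> y) u
        = word_action \<phi> H \<theta> \<Sigma> l x (word_action \<phi> H \<theta> \<Sigma> l y u)"
      if "x \<in> carrier (G \<times>\<times> H)" "y \<in> carrier (G \<times>\<times> H)" "u \<in> words \<Sigma> l" for x y u
      using that
      by (auto simp: word_action_def L.composition_rule P.composition_rule Lc Pc
          letter_position_commute[OF G H])
  qed (auto simp: word_action_def Lc Pc)
qed

end

theory Submission
  imports Defs
begin

text \<open>
  Reading the letter \<open>0\<close> as \<open>1\<close> and the letter \<open>1\<close> as \<open>-1\<close>, call the sum of a binary word its
  discrepancy. Permuting positions leaves only the numbers of zeros and ones of a word of length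
  \<open>l\<close>, that is, its discrepancy, and exchanging the letters changes the sign. So two words of
  length \<open>l\<close> are equivalent iff their discrepancies agree up to sign
  (\<open>same_orbit_iff_abs_discrepancy\<close>), and the complexity of \<open>w\<close> counts the absolute discrepancies
  of its factors of length \<open>l\<close>.

  The discrepancy of a factor is a difference of two prefix discrepancies. Both images \<open>0011\<close> and
  \<open>0110\<close> have discrepancy \<open>0\<close>, so the discrepancy of a prefix of \<open>w\<close> depends only on where it ends
  inside the current block. It visits \<open>0, 1, 2, 1\<close> in the blocks \<open>0011\<close> and \<open>0, 1, 0, -1\<close> in the
  blocks \<open>0110\<close>. Hence it stays between \<open>-1\<close> and \<open>2\<close>, and it has the parity of the length of the
  prefix. Therefore the absolute discrepancy of a factor is \<open>0\<close> or \<open>2\<close> if \<open>l\<close> is even, and \<open>1\<close> or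
  \<open>3\<close> if \<open>l\<close> is odd.

  That both values occur for \<open>l > 1\<close> needs factors which begin and end in blocks prescribed by
  distinct letters, at a prescribed distance. Thue-Morse provides them: at every positive distance
  it has a \<open>0\<close> followed by a \<open>1\<close>, and a \<open>1\<close> followed by a \<open>0\<close> (\<open>thue_morse_distinct_at_distance\<close>).

  Finally, all four binary words of length \<open>2\<close> are factors of \<open>w\<close>, whereas a Sturmian word has
  only three factors of this length.
\<close>

section \<open>Orbits of words under letter and position permutations\<close>

lemma carrier_BijGroup: "carrier (BijGroup S) = Bij S"
  by (simp add: BijGroup_def)

lemma (in group_action) same_orbit_iff:
  assumes "x \<in> E" "y \<in> E"
  shows "(\<exists>Orb \<in> orbits G E \<phi>. x \<in> Orb \<and> y \<in> Orb) \<longleftrightarrow> y \<in> orbit G \<phi> x"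
proof
  assume "\<exists>Orb \<in> orbits G E \<phi>. x \<in> Orb \<and> y \<in> Orb"
  then obtain z where z: "z \<in> E" "x \<in> orbit G \<phi> z" "y \<in> orbit G \<phi> z"
    by (auto simp: orbits_def)
  then show "y \<in> orbit G \<phi> x"
    using assms orbit_sym orbit_trans by blast
qed (use assms orbit_refl in \<open>auto simp: orbits_def\<close>)

lemma mset_permute_list_Bij:
  assumes "h \<in> Bij {..<length u}"
  shows "mset (permute_list h u) = mset u"
proof -
  let ?p = "\<lambda>i. if i < length u then h i else i"
  have "bij_betw ?p {..<length u} {..<length u}"
    using assms by (subst bij_betw_cong[where g = h]) (auto simp: Bij_def)
  then have "?p permutes {..<length u}"
    by (rule bij_imp_permutes) simp
  moreover have "permute_list h u = permute_list ?p u"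
    by (simp add: permute_list_def)
  ultimately show ?thesis by simp
qed

lemma mset_eq_imp_permute_list_Bij:
  assumes "mset u = mset v"
  obtains h where "h \<in> Bij {..<length u}" "permute_list h u = v"
proof -
  obtain p where p: "p permutes {..<length u}" "permute_list p u = v"
    using mset_eq_permutation[of v u] assms by auto
  let ?h = "restrict p {..<length u}"
  have "bij_betw ?h {..<length u} {..<length u}"
    using permutes_imp_bij[OF p(1)] by simp
  then have "?h \<in> Bij {..<length u}"
    by (simp add: Bij_def)
  moreover have "permute_list ?h u = v"
    using p(2) by (auto simp: permute_list_def)
  ultimately show thesis by (rule that)
qed

text \<open>
  Position permutations realise exactly the rearrangements of a word, hence an orbit only
  remembers the multiset of letters, up to renaming the letters.
\<close>

lemma same_orbit_iff_mset:
  assumes u: "u \<in> words \<Sigma> l" and v: "v \<in> words \<Sigma> l"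
  shows "(\<exists>Orb \<in> orbits (BijGroup \<Sigma> \<times>\<times> BijGroup {..<l}) (words \<Sigma> l)
             (word_action (\<lambda>g. g) (BijGroup {..<l}) (\<lambda>h. h) \<Sigma> l). u \<in> Orb \<and> v \<in> Orb)
         \<longleftrightarrow> (\<exists>g \<in> Bij \<Sigma>. mset v = image_mset g (mset u))"
    (is "?same \<longleftrightarrow> ?renamed")
proof -
  interpret A: group_action "BijGroup \<Sigma> \<times>\<times> BijGroup {..<l}" "words \<Sigma> l"
    "word_action (\<lambda>g. g) (BijGroup {..<l}) (\<lambda>h. h) \<Sigma> l"
    by (intro word_action group_action_BijGroup)
  interpret H: group "BijGroup {..<l}" by (rule group_BijGroup)
  have len: "length u = l" using u by (simp add: words_def)
  have act: "word_action (\<lambda>g. g) (BijGroup {..<l}) (\<lambda>h. h) \<Sigma> l (g, h) u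
      = map g (permute_list (inv\<^bsub>BijGroup {..<l}\<^esub> h) u)" if "h \<in> Bij {..<l}" for g h
  proof -
    have "inv\<^bsub>BijGroup {..<l}\<^esub> h \<in> Bij {..<length u}"
      using H.inv_closed that by (simp add: carrier_BijGroup len)
    then have "set (permute_list (inv\<^bsub>BijGroup {..<l}\<^esub> h) u) = set u"
      by (metis mset_permute_list_Bij set_mset_mset)
    then have "permute_list (inv\<^bsub>BijGroup {..<l}\<^esub> h) u \<in> words \<Sigma> l"
      using u by (simp add: words_def)
    then show ?thesis
      using u by (simp add: word_action_def letter_action_def position_action_def)
  qed
  have "?same \<longleftrightarrow> (\<exists>g \<in> Bij \<Sigma>. \<exists>h \<in> Bij {..<l}.
      v = word_action (\<lambda>g. g) (BijGroup {..<l}) (\<lambda>h. h) \<Sigma> l (g, h) u)"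
    unfolding A.same_orbit_iff[OF u v] by (auto simp: orbit_def carrier_BijGroup)
  also have "\<dots> \<longleftrightarrow>
      (\<exists>g \<in> Bij \<Sigma>. \<exists>h \<in> Bij {..<l}. v = map g (permute_list (inv\<^bsub>BijGroup {..<l}\<^esub> h) u))"
    by (simp add: act)
  also have "\<dots> \<longleftrightarrow> (\<exists>g \<in> Bij \<Sigma>. \<exists>h \<in> Bij {..<l}. v = map g (permute_list h u))"
  proof (rule bex_cong[OF refl], rule iffI)
    fix g assume "\<exists>h \<in> Bij {..<l}. v = map g (permute_list (inv\<^bsub>BijGroup {..<l}\<^esub> h) u)"
    then show "\<exists>h \<in> Bij {..<l}. v = map g (permute_list h u)"
      using H.inv_closed[unfolded carrier_BijGroup] by blast
  next
    fix g assume "\<exists>h \<in> Bij {..<l}. v = map g (permute_list h u)"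
    then obtain h where h: "h \<in> Bij {..<l}" "v = map g (permute_list h u)" by blast
    show "\<exists>h \<in> Bij {..<l}. v = map g (permute_list (inv\<^bsub>BijGroup {..<l}\<^esub> h) u)"
      using h H.inv_closed[unfolded carrier_BijGroup] H.inv_inv[unfolded carrier_BijGroup]
      by (intro bexI[of _ "inv\<^bsub>BijGroup {..<l}\<^esub> h"]) simp_all
  qed
  also have "\<dots> \<longleftrightarrow> ?renamed"
  proof (rule bex_cong[OF refl], rule iffI)
    fix g assume "\<exists>h \<in> Bij {..<l}. v = map g (permute_list h u)"
    then show "mset v = image_mset g (mset u)"
      using mset_permute_list_Bij[of _ u] len by auto
  next
    fix g assume "mset v = image_mset g (mset u)"
    then have "mset (map g u) = mset v" by simp
    then obtain h where h: "h \<in> Bij {..<l}" "permute_list h (map g u) = v"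
      using mset_eq_imp_permute_list_Bij[of "map g u" v] len by auto
    have "h i < length u" if "i < length u" for i
      using Bij_imp_funcset[OF h(1)] that len by auto
    then have "v = map g (permute_list h u)"
      using h(2) by (auto simp: permute_list_def)
    then show "\<exists>h \<in> Bij {..<l}. v = map g (permute_list h u)"
      using h(1) by blast
  qed
  finally show ?thesis .
qed


section \<open>Discrepancy of binary words\<close>

definition letter_sign :: "nat \<Rightarrow> int" where
  "letter_sign a = (if a = 0 then 1 else -1)"

definition discrepancy :: "nat list \<Rightarrow> int" where
  "discrepancy u = (\<Sum>a\<leftarrow>u. letter_sign a)"

lemma discrepancy_append: "discrepancy (u @ v) = discrepancy u + discrepancy v"
  by (simp add: discrepancy_def)

lemma binary_word_counts:
  assumes "u \<in> words binary l"
  shows "int (count (mset u) 0) + int (count (mset u) 1) = int l"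
    and "int (count (mset u) 0) - int (count (mset u) 1) = discrepancy u"
proof -
  have "set u \<subseteq> binary" "length u = l" using assms by (auto simp: words_def)
  then have "int (count (mset u) 0) + int (count (mset u) 1) = int l \<and>
      int (count (mset u) 0) - int (count (mset u) 1) = discrepancy u"
    by (induction u arbitrary: l) (auto simp: discrepancy_def letter_sign_def)
  then show "int (count (mset u) 0) + int (count (mset u) 1) = int l"
    and "int (count (mset u) 0) - int (count (mset u) 1) = discrepancy u" by blast+
qed

lemma binary_mset_eq_iff:
  assumes u: "u \<in> words binary l" and v: "v \<in> words binary l"
  shows "mset u = mset v \<longleftrightarrow> discrepancy u = discrepancy v"
proof
  assume "mset u = mset v"
  then show "discrepancy u = discrepancy v"
    using binary_word_counts(2)[OF u] binary_word_counts(2)[OF v] by simp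
next
  assume d: "discrepancy u = discrepancy v"
  show "mset u = mset v"
  proof (rule multiset_eqI)
    fix a
    show "count (mset u) a = count (mset v) a"
    proof (cases "a \<in> binary")
      case True
      then show ?thesis
        using d binary_word_counts[OF u] binary_word_counts[OF v] by auto
    next
      case False
      then have "a \<notin># mset u" "a \<notin># mset v" using u v by (auto simp: words_def)
      then show ?thesis by (simp only: not_in_iff)
    qed
  qed
qed

text \<open>
  The permutations of the alphabet are the identity and the exchange, which negates discrepancies.
\<close>

lemma same_orbit_iff_abs_discrepancy:
  assumes u: "u \<in> words binary l" and v: "v \<in> words binary l"
  shows "(\<exists>Orb \<in> orbits (BijGroup binary \<times>\<times> BijGroup {..<l}) (words binary l)
             (word_action (\<lambda>g. g) (BijGroup {..<l}) (\<lambda>h. h) binary l). u \<in> Orb \<and> v \<in> Orb)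
         \<longleftrightarrow> \<bar>discrepancy u\<bar> = \<bar>discrepancy v\<bar>"
proof -
  let ?swap = "\<lambda>a\<in>binary. 1 - a"
  have cases: "(\<forall>a\<in>binary. g a = a) \<or> (\<forall>a\<in>binary. g a = ?swap a)" if "g \<in> Bij binary" for g
  proof -
    have "g 0 \<in> binary" "g 1 \<in> binary"
      using Bij_imp_funcset[OF that] by blast+
    moreover have "g 0 \<noteq> g 1"
      using that by (metis Bij_def Int_iff bij_betw_imp_inj_on inj_on_contraD insertCI mem_Collect_eq zero_neq_one)
    ultimately show ?thesis by fastforce
  qed
  have id: "(\<lambda>a\<in>binary. a) \<in> Bij binary" by (rule id_Bij)
  have swap: "?swap \<in> Bij binary"
    by (auto simp: Bij_def bij_betw_def inj_on_def)
  have image_cong: "image_mset g (mset u) = image_mset h (mset u)" if "\<forall>a\<in>binary. g a = h a" for g h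
    using that u by (auto simp: words_def intro!: image_mset_cong)
  have image_id: "image_mset (\<lambda>a\<in>binary. a) (mset u) = mset u"
    using image_cong[of "\<lambda>a\<in>binary. a" "\<lambda>a. a"] by simp
  have swapped: "map ?swap u \<in> words binary l"
    using u by (auto simp: words_def)
  have "set u \<subseteq> binary" using u by (simp add: words_def)
  then have discrepancy_swapped: "discrepancy (map ?swap u) = - discrepancy u"
    by (induction u) (auto simp: discrepancy_def letter_sign_def)
  have "(\<exists>g \<in> Bij binary. mset v = image_mset g (mset u))
      \<longleftrightarrow> mset v = mset u \<or> mset v = mset (map ?swap u)"
  proof
    assume "\<exists>g \<in> Bij binary. mset v = image_mset g (mset u)"
    then obtain g where g: "g \<in> Bij binary" "mset v = image_mset g (mset u)" by blast
    show "mset v = mset u \<or> mset v = mset (map ?swap u)"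
      using cases[OF g(1)]
    proof
      assume "\<forall>a\<in>binary. g a = a"
      then show ?thesis using image_cong[of g "\<lambda>a. a"] g(2) by simp
    next
      assume "\<forall>a\<in>binary. g a = ?swap a"
      then show ?thesis using image_cong[of g ?swap] g(2) by simp
    qed
  next
    assume "mset v = mset u \<or> mset v = mset (map ?swap u)"
    then show "\<exists>g \<in> Bij binary. mset v = image_mset g (mset u)"
    proof
      assume "mset v = mset u"
      then show ?thesis by (intro bexI[OF _ id]) (simp only: image_id)
    next
      assume "mset v = mset (map ?swap u)"
      then show ?thesis by (intro bexI[OF _ swap]) simp
    qed
  qed
  also have "\<dots> \<longleftrightarrow> discrepancy v = discrepancy u \<or> discrepancy v = - discrepancy u"
    by (simp only: binary_mset_eq_iff[OF v u] binary_mset_eq_iff[OF v swapped] discrepancy_swapped)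
  also have "\<dots> \<longleftrightarrow> \<bar>discrepancy u\<bar> = \<bar>discrepancy v\<bar>"
    by linarith
  finally show ?thesis
    by (simp only: same_orbit_iff_mset[OF u v])
qed

lemma card_quotient_eq_card_image:
  "card (A // {(x, y). x \<in> A \<and> y \<in> A \<and> f x = f y}) = card (f ` A)"
proof -
  let ?fibre = "\<lambda>b. {x \<in> A. b = f x}"
  have "A // {(x, y). x \<in> A \<and> y \<in> A \<and> f x = f y} = ?fibre ` f ` A"
    by (auto simp: quotient_def)
  moreover have "inj_on ?fibre (f ` A)"
    by (rule inj_onI) blast
  ultimately show ?thesis
    by (simp add: card_image)
qed

lemma factors_eq_range: "factors l w = range (\<lambda>i. stake l (sdrop i w))"
  by (auto simp: factors_def)

lemma factors_subset_words: "w \<in> streams \<Sigma> \<Longrightarrow> factors l w \<subseteq> words \<Sigma> l"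
  by (auto simp: factors_def words_def streams_iff_snth in_set_conv_nth sdrop_snth)

lemma symmetric_complexity_binary:
  assumes "w \<in> streams binary"
  shows "symmetric_complexity binary w l = card ((\<lambda>u. \<bar>discrepancy u\<bar>) ` factors l w)"
proof -
  note same_orbit = same_orbit_iff_abs_discrepancy[OF subsetD subsetD,
      OF factors_subset_words[OF assms] _ factors_subset_words[OF assms]]
  have "factor_equiv (BijGroup binary) (\<lambda>g. g) (BijGroup {..<l}) (\<lambda>h. h) binary w l
      = {(u, v). u \<in> factors l w \<and> v \<in> factors l w \<and> \<bar>discrepancy u\<bar> = \<bar>discrepancy v\<bar>}"
    unfolding factor_equiv_def by (simp only: same_orbit cong: conj_cong)
  then show ?thesis
    by (simp add: symmetric_complexity_def group_complexity_def card_quotient_eq_card_image)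
qed

lemma discrepancy_factor:
  "discrepancy (stake l (sdrop i w)) = discrepancy (stake (i + l) w) - discrepancy (stake i w)"
proof -
  have "stake (i + l) w = stake i w @ stake l (sdrop i w)"
    by (simp only: stake_add)
  then show ?thesis by (simp only: discrepancy_append)
qed


section \<open>Distinct letters of Thue--Morse at a given distance\<close>

lemma thue_morse_binary: "thue_morse !! n = 0 \<or> thue_morse !! n = 1"
  using thue_morse_fixed_point(1) by (simp add: streams_iff_snth)

lemma thue_morse_snth: "thue_morse !! n = tm_morphism (thue_morse !! (n div 2)) ! (n mod 2)"
  using snth_morphic_image[of 2 tm_morphism thue_morse n]
  by (simp add: thue_morse_fixed_point(3)) (simp add: tm_morphism_def)

text \<open>
  Halving both indices \<open>k\<close> times reduces the claim to the first two letters \<open>0\<close> and \<open>1\<close> of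
  Thue--Morse; the way back applies the same steps of the morphism to both letters, and
  \<open>0 \<mapsto> 01\<close>, \<open>1 \<mapsto> 10\<close> commutes with exchanging the letters.
\<close>

lemma thue_morse_add_power:
  "m < 2 ^ k \<Longrightarrow> thue_morse !! (2 ^ k + m) = 1 - thue_morse !! m"
proof (induction k arbitrary: m)
  case 0
  then show ?case
    using thue_morse_snth[of 1] thue_morse_fixed_point(2) by (simp add: tm_morphism_def)
next
  case (Suc k)
  have "(2 ^ Suc k + m) div 2 = 2 ^ k + m div 2" and "(2 ^ Suc k + m) mod 2 = m mod 2"
    by simp_all
  then have "thue_morse !! (2 ^ Suc k + m) = tm_morphism (thue_morse !! (2 ^ k + m div 2)) ! (m mod 2)"
    by (subst thue_morse_snth) simp
  also have "\<dots> = tm_morphism (1 - thue_morse !! (m div 2)) ! (m mod 2)"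
    using Suc by simp
  also have "\<dots> = 1 - tm_morphism (thue_morse !! (m div 2)) ! (m mod 2)"
    using thue_morse_binary[of "m div 2"]
    by (cases "even m") (auto simp: tm_morphism_def even_iff_mod_2_eq_zero odd_iff_mod_2_eq_one)
  finally show ?case by (simp add: thue_morse_snth[of m])
qed

text \<open>
  Let \<open>N\<close> be a power of two above \<open>k\<close>. Both \<open>N\<close> and \<open>2 * N\<close> carry the letter \<open>1\<close>, while the
  letters at distance \<open>k\<close> before them are complementary, because \<open>2 * N - k\<close> and \<open>N - k\<close> differ by
  \<open>N\<close>; so one of the two pairs reads \<open>0, 1\<close>. Adding a larger power of two complements the pair.
\<close>

lemma thue_morse_distinct_at_distance:
  assumes "k > 0" and "a = 0 \<or> a = 1"
  obtains p where "thue_morse !! p = a" "thue_morse !! (p + k) = 1 - a"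
proof -
  define N :: nat where "N = 2 ^ k"
  have N: "k < N" "N > 0" by (simp_all add: N_def)
  have one: "thue_morse !! N = 1" "thue_morse !! (2 * N) = 1"
    using thue_morse_add_power[of 0 k] thue_morse_add_power[of 0 "Suc k"] thue_morse_fixed_point(2)
    by (simp_all add: N_def)
  have "thue_morse !! (N + (N - k)) = 1 - thue_morse !! (N - k)"
    using thue_morse_add_power[of "N - k" k] N assms(1) by (simp add: N_def)
  then have compl: "thue_morse !! (2 * N - k) = 1 - thue_morse !! (N - k)"
    using N by (simp add: mult_2)
  obtain M where M: "M \<le> 2 * N" "k \<le> M" "thue_morse !! (M - k) = 0" "thue_morse !! M = 1"
  proof (cases "thue_morse !! (N - k) = 0")
    case True
    then show thesis using that[of N] N one by simp
  next
    case False
    then have "thue_morse !! (2 * N - k) = 0"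
      using compl thue_morse_binary[of "N - k"] by simp
    then show thesis using that[of "2 * N"] N one by simp
  qed
  show thesis
  proof (cases "a = 0")
    case True
    then show thesis using that[of "M - k"] M by simp
  next
    case False
    let ?P = "2 ^ (k + 2) :: nat"
    have "?P = 4 * N" by (simp add: N_def)
    then have "M < ?P" "M - k < ?P" using M N by linarith+
    then have "thue_morse !! (?P + (M - k)) = 1" "thue_morse !! (?P + M) = 0"
      using thue_morse_add_power[of "M - k" "k + 2"] thue_morse_add_power[of M "k + 2"] M
      by simp_all
    moreover have "?P + (M - k) + k = ?P + M" using M by simp
    ultimately show thesis
      using that[of "?P + (M - k)"] False assms(2) by simp
  qed
qed


section \<open>Factors of the image of Thue--Morse\<close>

abbreviation psi_tm :: "nat stream" where
  "psi_tm \<equiv> morphic_image psi thue_morse"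

lemma psi_tm_snth: "psi_tm !! n = psi (thue_morse !! (n div 4)) ! (n mod 4)"
  by (rule snth_morphic_image) (simp_all add: psi_def)

lemma less_4_cases: "r < 4 \<Longrightarrow> r = 0 \<or> r = 1 \<or> r = 2 \<or> r = (3::nat)"
  by auto

lemma psi_tm_binary: "psi_tm \<in> streams binary"
proof -
  have "psi a ! (n mod 4) \<in> binary" for a n
    using less_4_cases[of "n mod 4"] by (auto simp: psi_def)
  then show ?thesis by (simp only: streams_iff_snth psi_tm_snth) blast
qed

text \<open>Complete blocks have discrepancy \<open>0\<close>, so only the current block contributes.\<close>

lemma discrepancy_prefix:
  "discrepancy (stake n psi_tm) = discrepancy (take (n mod 4) (psi (thue_morse !! (n div 4))))"
proof (induction n)
  case 0
  then show ?case by (simp add: discrepancy_def)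
next
  case (Suc n)
  let ?b = "psi (thue_morse !! (n div 4))"
  have len: "length ?b = 4" by (simp add: psi_def)
  have "discrepancy (stake (Suc n) psi_tm) = discrepancy (stake n psi_tm @ [?b ! (n mod 4)])"
    by (simp add: stake_Suc psi_tm_snth del: stake.simps)
  also have "\<dots> = discrepancy (take (Suc (n mod 4)) ?b)"
    using len by (simp add: discrepancy_append Suc.IH take_Suc_conv_app_nth)
  also have "\<dots> = discrepancy (take (Suc n mod 4) (psi (thue_morse !! (Suc n div 4))))"
  proof (cases "Suc (n mod 4) = 4")
    case True
    have "discrepancy ?b = 0" by (simp add: psi_def discrepancy_def letter_sign_def)
    then show ?thesis using True len by (simp add: mod_Suc discrepancy_def)
  next
    case False
    then show ?thesis by (simp add: mod_Suc div_Suc)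
  qed
  finally show ?case .
qed

lemma discrepancy_prefix_values:
  "discrepancy (stake (4 * q) psi_tm) = 0"
  "discrepancy (stake (4 * q + 1) psi_tm) = 1"
  "discrepancy (stake (4 * q + 2) psi_tm) = (if thue_morse !! q = 0 then 2 else 0)"
  "discrepancy (stake (4 * q + 3) psi_tm) = (if thue_morse !! q = 0 then 1 else -1)"
proof -
  have "discrepancy (stake (4 * q + r) psi_tm) = discrepancy (take r (psi (thue_morse !! q)))"
    if "r < 4" for r
    using discrepancy_prefix[of "4 * q + r"] that by simp
  from this[of 0] this[of 1] this[of 2] this[of 3] show
    "discrepancy (stake (4 * q) psi_tm) = 0"
    "discrepancy (stake (4 * q + 1) psi_tm) = 1"
    "discrepancy (stake (4 * q + 2) psi_tm) = (if thue_morse !! q = 0 then 2 else 0)"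
    "discrepancy (stake (4 * q + 3) psi_tm) = (if thue_morse !! q = 0 then 1 else -1)"
    by (simp_all add: psi_def discrepancy_def letter_sign_def take_Cons' del: stake.simps)
qed

lemma discrepancy_prefix_bounds:
  "-1 \<le> discrepancy (stake n psi_tm)" "discrepancy (stake n psi_tm) \<le> 2"
  "even (discrepancy (stake n psi_tm)) \<longleftrightarrow> even n"
proof -
  define q where "q = n div 4"
  consider "n = 4 * q" | "n = 4 * q + 1" | "n = 4 * q + 2" | "n = 4 * q + 3"
    using less_4_cases[of "n mod 4"] by (force simp: q_def)
  then have "-1 \<le> discrepancy (stake n psi_tm) \<and> discrepancy (stake n psi_tm) \<le> 2 \<and>
      (even (discrepancy (stake n psi_tm)) \<longleftrightarrow> even n)"
    by cases (simp_all only: discrepancy_prefix_values, simp_all?)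
  then show "-1 \<le> discrepancy (stake n psi_tm)" "discrepancy (stake n psi_tm) \<le> 2"
    "even (discrepancy (stake n psi_tm)) \<longleftrightarrow> even n" by blast+
qed

definition factor_discrepancies :: "nat \<Rightarrow> int set" where
  "factor_discrepancies l = (\<lambda>u. \<bar>discrepancy u\<bar>) ` factors l psi_tm"

lemma factor_discrepancies_alt:
  "factor_discrepancies l
     = range (\<lambda>i. \<bar>discrepancy (stake (i + l) psi_tm) - discrepancy (stake i psi_tm)\<bar>)"
  by (simp add: factor_discrepancies_def factors_eq_range image_image discrepancy_factor)

lemma factor_discrepanciesI:
  "x = \<bar>discrepancy (stake j psi_tm) - discrepancy (stake i psi_tm)\<bar> \<Longrightarrow> j = i + l
    \<Longrightarrow> x \<in> factor_discrepancies l"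
  by (auto simp: factor_discrepancies_alt)

lemma factor_discrepancies_subset:
  "factor_discrepancies l \<subseteq> (if even l then {0, 2} else {1, 3})"
proof
  fix x assume "x \<in> factor_discrepancies l"
  then obtain i where
    x: "x = \<bar>discrepancy (stake (i + l) psi_tm) - discrepancy (stake i psi_tm)\<bar>"
    by (auto simp: factor_discrepancies_alt)
  have "0 \<le> x" "x \<le> 3" using discrepancy_prefix_bounds[of i] discrepancy_prefix_bounds[of "i + l"]
    unfolding x by linarith+
  then have "x = 0 \<or> x = 1 \<or> x = 2 \<or> x = 3" by linarith
  moreover have "even x \<longleftrightarrow> even l"
    using discrepancy_prefix_bounds(3)[of i] discrepancy_prefix_bounds(3)[of "i + l"]
    unfolding x by auto
  ultimately show "x \<in> (if even l then {0, 2} else {1, 3})" by auto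
qed

lemma factor_discrepancies_1: "factor_discrepancies 1 = {1}"
proof -
  have "\<bar>discrepancy (stake 1 (sdrop i psi_tm))\<bar> = 1" for i
    by (simp add: discrepancy_def letter_sign_def)
  then show ?thesis
    by (simp only: factor_discrepancies_def factors_eq_range image_image) simp
qed

text \<open>
  For odd \<open>l\<close>, the value \<open>3\<close> is the difference between the maximum \<open>2\<close>, in the middle of a block
  \<open>0011\<close>, and the minimum \<open>-1\<close>, before the last letter of a block \<open>0110\<close>; the residue of \<open>l\<close>
  modulo \<open>4\<close> decides which of the two comes first. For \<open>l\<close> divisible by \<open>4\<close>, the value \<open>2\<close>
  separates the middles of two blocks of different kind.
\<close>

lemma factor_discrepancies_eq:
  assumes "l > 1"
  shows "factor_discrepancies l = (if even l then {0, 2} else {1, 3})"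
proof -
  define k where "k = l div 4"
  have "(if even l then {0, 2} else {1, 3}) \<subseteq> factor_discrepancies l"
  proof -
    have l: "l = 4 * k + l mod 4" by (simp add: k_def)
    consider "l = 4 * k" | "l = 4 * k + 1" | "l = 4 * k + 2" | "l = 4 * k + 3"
      using l less_4_cases[of "l mod 4"] by auto
    then show ?thesis
    proof cases
      case 1
      then have "k > 0" using assms by simp
      then obtain p where p: "thue_morse !! p = 0" "thue_morse !! (p + k) = 1"
        using thue_morse_distinct_at_distance[of k 0] by auto
      have "0 \<in> factor_discrepancies l"
        by (rule factor_discrepanciesI[where i = "4 * 0" and j = "4 * k"])
          (simp_all only: discrepancy_prefix_values 1)
      moreover have "2 \<in> factor_discrepancies l"
        by (rule factor_discrepanciesI[where i = "4 * p + 2" and j = "4 * (p + k) + 2"])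
          (simp_all only: discrepancy_prefix_values p 1, simp_all?)
      ultimately show ?thesis using 1 by simp
    next
      case 2
      then have "k > 0" using assms by simp
      then obtain p where p: "thue_morse !! p = 0" "thue_morse !! (p + k) = 1"
        using thue_morse_distinct_at_distance[of k 0] by auto
      have "1 \<in> factor_discrepancies l"
        by (rule factor_discrepanciesI[where i = "4 * 0" and j = "4 * k + 1"])
          (simp_all only: discrepancy_prefix_values 2, simp_all?)
      moreover have "3 \<in> factor_discrepancies l"
        by (rule factor_discrepanciesI[where i = "4 * p + 2" and j = "4 * (p + k) + 3"])
          (simp_all only: discrepancy_prefix_values p 2, simp_all?)
      ultimately show ?thesis using 2 by simp
    next
      case 3
      \<comment> \<open>A factor that starts with a block ends in the middle of a block, and the letter of that
        block alone decides the value. It suffices that both letters occur from index \<open>k + 1\<close> on.\<close>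
      obtain p where p: "thue_morse !! (p + Suc k) = 1"
        using thue_morse_distinct_at_distance[of "Suc k" 0] by auto
      obtain q where q: "thue_morse !! (q + Suc k) = 0"
        using thue_morse_distinct_at_distance[of "Suc k" 1] by auto
      have "0 \<in> factor_discrepancies l"
        by (rule factor_discrepanciesI[where i = "4 * Suc p" and j = "4 * (p + Suc k) + 2"])
          (simp_all only: discrepancy_prefix_values p 3, simp_all?)
      moreover have "2 \<in> factor_discrepancies l"
        by (rule factor_discrepanciesI[where i = "4 * Suc q" and j = "4 * (q + Suc k) + 2"])
          (simp_all only: discrepancy_prefix_values q 3, simp_all?)
      ultimately show ?thesis using 3 by simp
    next
      case 4
      \<comment> \<open>A factor from offset \<open>3\<close> to offset \<open>2\<close> crosses \<open>k + 1\<close> block boundaries.\<close>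
      obtain p where p: "thue_morse !! p = 1" "thue_morse !! (p + Suc k) = 0"
        using thue_morse_distinct_at_distance[of "Suc k" 1] by auto
      have "1 \<in> factor_discrepancies l"
        by (rule factor_discrepanciesI[where i = "4 * 0" and j = "4 * k + 3"])
          (simp_all only: discrepancy_prefix_values 4, simp_all?)
      moreover have "3 \<in> factor_discrepancies l"
        by (rule factor_discrepanciesI[where i = "4 * p + 3" and j = "4 * (p + Suc k) + 2"])
          (simp_all only: discrepancy_prefix_values p 4, simp_all?)
      ultimately show ?thesis using 4 by simp
    qed
  qed
  then show ?thesis using factor_discrepancies_subset by blast
qed

lemma psi_tm_not_sturmian: "\<not> sturmian psi_tm"
proof
  assume "sturmian psi_tm"
  then have card: "card (factors 2 psi_tm) = 3" by (simp add: sturmian_def)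
  have "thue_morse !! 0 = 0" "thue_morse !! 1 = 1"
    using thue_morse_fixed_point(2) thue_morse_add_power[of 0 0] by simp_all
  then have letters: "psi_tm !! 0 = 0" "psi_tm !! 1 = 0" "psi_tm !! 2 = 1" "psi_tm !! 3 = 1"
    "psi_tm !! 6 = 1" "psi_tm !! 7 = 0"
    by (simp_all only: psi_tm_snth) (simp_all add: psi_def)
  have pair: "[psi_tm !! i, psi_tm !! Suc i] \<in> factors 2 psi_tm" for i
    by (auto simp: factors_def numeral_2_eq_2 sdrop_simps intro!: exI[of _ i])
  have "{[0, 0], [0, 1], [1, 1], [1, 0]} \<subseteq> factors 2 psi_tm"
    using pair[of 0] pair[of 1] pair[of 2] pair[of 6] letters
    by (simp add: numeral_2_eq_2 numeral_3_eq_3)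
  moreover have "finite (factors 2 psi_tm)" using card by (intro card_ge_0_finite) simp
  ultimately have "card {[0, 0], [0, 1], [1, 1], [1, 0 :: nat]} \<le> card (factors 2 psi_tm)"
    by (intro card_mono)
  then show False using card by simp
qed

theorem proposition3p8:
  fixes w :: "nat stream"
  assumes "w = morphic_image psi thue_morse"
  shows "(\<forall>l>0. symmetric_complexity binary w l = (if l = 1 then 1 else 2)) \<and> \<not> sturmian w"
proof -
  have "symmetric_complexity binary w l = (if l = 1 then 1 else 2)" if "l > 0" for l
  proof -
    have "symmetric_complexity binary w l = card (factor_discrepancies l)"
      unfolding assms factor_discrepancies_def by (rule symmetric_complexity_binary[OF psi_tm_binary])
    then show ?thesis
      using that factor_discrepancies_1 factor_discrepancies_eq[of l] by (cases "l = 1") auto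
  qed
  then show ?thesis using assms psi_tm_not_sturmian by simp
qed

end
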